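(* $\mathrm{TPTL}[F]\not\subseteq\mathrm{MTL}[U,S]$ over strictly monotonic timed words, and hence also over weakly monotonic timed words: there is a TPTL$[F]$ formula $\phi$ such that no MTL$[U,S]$ formula $\psi$ is satisfied (at position 1) by exactly the same strictly monotonic timed words as $\phi$.
   Context: Fix a finite alphabet $\Sigma$. A (weakly monotonic) timed word is $\rho=(\sigma_1,\tau_1)\cdots(\sigma_n,\tau_n)$, $n\ge1$, $\sigma_i\in\Sigma$, $\tau_i\in\mathbb{R}_{\ge0}$, $\tau_1=0$, $\tau_i\le\tau_{i+1}$; strictly monotonic if $\tau_i<\tau_{i+1}$. An interval is a convex subset of $\mathbb{R}_{\ge0}$ with endpoints non-negative integers or $\infty$. MTL$[U,S]$: $\phi::=a\mid\phi\wedge\phi\mid\neg\phi\mid\phi U_I\phi\mid\phi S_I\phi$ ($a\in\Sigma$, $I$ any interval), with $\rho,i\models a$ iff $\sigma_i=a$, $\rho,i\models\phi_1U_I\phi_2$ iff $\exists j>i$: $\rho,j\models\phi_2$, $\tau_j-\tau_i\in I$, $\forall i<k<j$: $\rho,k\models\phi_1$; $\rho,i\models\phi_1S_I\phi_2$ iff $\exists j<i$: $\rho,j\models\phi_2$, $\tau_i-\tau_j\in I$, $\forall j<k<i$: $\rho,k\models\phi_1$. TPTL$[F]$: fix a finite set $\mathcal{X}$ of freeze variables; valuations $\nu:\mathcal{X}\to\mathbb{R}_{\ge0}$, $\nu_0\equiv0$; guards $g::=g\wedge g\mid x-T\approx c$ with $\approx\in\{<,\le,>,\ge,=\}$, $c\in\mathbb{Z}$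 (so $T-x\approx c$ is also expressible), $\nu,t\models x-T\approx c$ iff $\nu(x)-t\approx c$; formulas $\phi::=a\mid g\mid F\phi\mid x.\phi\mid\phi\vee\phi\mid\neg\phi$, with $\rho,i,\nu\models g$ iff $\nu,\tau_i\models g$, $\rho,i,\nu\models F\phi$ iff $\exists j>i$: $\rho,j,\nu\models\phi$, $\rho,i,\nu\models x.\phi$ iff $\rho,i,\nu[x\mapsto\tau_i]\models\phi$. A TPTL formula holds of $\rho$ if $\rho,1,\nu_0\models\phi$; an MTL formula if $\rho,1\models\psi$. *)

theory Defs
  imports Complex_Main
begin

text \<open>
  Positions are list indices, so position \<open>i\<close> of the usual 1-based numbering is index \<open>i - 1\<close>.
\<close>

type_synonym 'a tword = "('a \<times> real) list"

definition letter :: "'a tword \<Rightarrow> nat \<Rightarrow> 'a" where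
  "letter \<rho> i = fst (\<rho> ! i)"

definition time :: "'a tword \<Rightarrow> nat \<Rightarrow> real" where
  "time \<rho> i = snd (\<rho> ! i)"

definition timed_word :: "'a tword \<Rightarrow> bool" where
  "timed_word \<rho> \<longleftrightarrow> \<rho> \<noteq> [] \<and> (\<forall>i < length \<rho>. time \<rho> i \<ge> 0) \<and> time \<rho> 0 = 0 \<and>
     (\<forall>i. Suc i < length \<rho> \<longrightarrow> time \<rho> i \<le> time \<rho> (Suc i))"

definition strict_timed_word :: "'a tword \<Rightarrow> bool" where
  "strict_timed_word \<rho> \<longleftrightarrow> timed_word \<rho> \<and>
     (\<forall>i. Suc i < length \<rho> \<longrightarrow> time \<rho> i < time \<rho> (Suc i))"

typedef nat_interval =
  "{I :: real set. \<exists>a b :: nat.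
      I = {real a..real b} \<or> I = {real a..<real b} \<or>
      I = {real a<..real b} \<or> I = {real a<..<real b} \<or>
      I = {real a..} \<or> I = {real a<..}}"
  by blast

datatype 'a mtl =
    MLetter 'a
  | MAnd "'a mtl" "'a mtl"
  | MNot "'a mtl"
  | MUntil "'a mtl" nat_interval "'a mtl"
  | MSince "'a mtl" nat_interval "'a mtl"

primrec mtl_sat :: "'a tword \<Rightarrow> nat \<Rightarrow> 'a mtl \<Rightarrow> bool" where
  "mtl_sat \<rho> i (MLetter a) \<longleftrightarrow> letter \<rho> i = a"
| "mtl_sat \<rho> i (MAnd \<phi> \<psi>) \<longleftrightarrow> mtl_sat \<rho> i \<phi> \<and> mtl_sat \<rho> i \<psi>"
| "mtl_sat \<rho> i (MNot \<phi>) \<longleftrightarrow> \<not> mtl_sat \<rho> i \<phi>"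
| "mtl_sat \<rho> i (MUntil \<phi> I \<psi>) \<longleftrightarrow>
     (\<exists>j. i < j \<and> j < length \<rho> \<and> mtl_sat \<rho> j \<psi> \<and> time \<rho> j - time \<rho> i \<in> Rep_nat_interval I \<and>
       (\<forall>k. i < k \<and> k < j \<longrightarrow> mtl_sat \<rho> k \<phi>))"
| "mtl_sat \<rho> i (MSince \<phi> I \<psi>) \<longleftrightarrow>
     (\<exists>j. j < i \<and> mtl_sat \<rho> j \<psi> \<and> time \<rho> i - time \<rho> j \<in> Rep_nat_interval I \<and>
       (\<forall>k. j < k \<and> k < i \<longrightarrow> mtl_sat \<rho> k \<phi>))"

definition mtl_holds :: "'a tword \<Rightarrow> 'a mtl \<Rightarrow> bool" where
  "mtl_holds \<rho> \<psi> \<longleftrightarrow> mtl_sat \<rho> 0 \<psi>"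

datatype cmp = Lt | Le | Gt | Ge | Eq

primrec cmp_rel :: "cmp \<Rightarrow> real \<Rightarrow> real \<Rightarrow> bool" where
  "cmp_rel Lt u v \<longleftrightarrow> u < v"
| "cmp_rel Le u v \<longleftrightarrow> u \<le> v"
| "cmp_rel Gt u v \<longleftrightarrow> u > v"
| "cmp_rel Ge u v \<longleftrightarrow> u \<ge> v"
| "cmp_rel Eq u v \<longleftrightarrow> u = v"

text \<open>\<open>GCmp x r c\<close> is the guard \<open>x - T r c\<close>, where \<open>T\<close> denotes the current time.\<close>

datatype 'x guard =
    GAnd "'x guard" "'x guard"
  | GCmp 'x cmp int

primrec guard_sat :: "('x \<Rightarrow> real) \<Rightarrow> real \<Rightarrow> 'x guard \<Rightarrow> bool" where
  "guard_sat \<nu> t (GAnd g h) \<longleftrightarrow> guard_sat \<nu> t g \<and> guard_sat \<nu> t h"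
| "guard_sat \<nu> t (GCmp x r c) \<longleftrightarrow> cmp_rel r (\<nu> x - t) (real_of_int c)"

datatype ('a, 'x) tptl =
    TLetter 'a
  | TGuard "'x guard"
  | TF "('a, 'x) tptl"
  | TFreeze 'x "('a, 'x) tptl"
  | TOr "('a, 'x) tptl" "('a, 'x) tptl"
  | TNot "('a, 'x) tptl"

text \<open>
  Valuations are typed into the reals; those arising from the zero valuation on a timed word
  are automatically non-negative.
\<close>

primrec tptl_sat :: "'a tword \<Rightarrow> nat \<Rightarrow> ('x \<Rightarrow> real) \<Rightarrow> ('a, 'x) tptl \<Rightarrow> bool" where
  "tptl_sat \<rho> i \<nu> (TLetter a) \<longleftrightarrow> letter \<rho> i = a"
| "tptl_sat \<rho> i \<nu> (TGuard g) \<longleftrightarrow> guard_sat \<nu> (time \<rho> i) g"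
| "tptl_sat \<rho> i \<nu> (TF \<phi>) \<longleftrightarrow> (\<exists>j. i < j \<and> j < length \<rho> \<and> tptl_sat \<rho> j \<nu> \<phi>)"
| "tptl_sat \<rho> i \<nu> (TFreeze x \<phi>) \<longleftrightarrow> tptl_sat \<rho> i (\<nu>(x := time \<rho> i)) \<phi>"
| "tptl_sat \<rho> i \<nu> (TOr \<phi> \<psi>) \<longleftrightarrow> tptl_sat \<rho> i \<nu> \<phi> \<or> tptl_sat \<rho> i \<nu> \<psi>"
| "tptl_sat \<rho> i \<nu> (TNot \<phi>) \<longleftrightarrow> \<not> tptl_sat \<rho> i \<nu> \<phi>"

definition tptl_holds :: "'a tword \<Rightarrow> ('a, 'x) tptl \<Rightarrow> bool" where
  "tptl_holds \<rho> \<phi> \<longleftrightarrow> tptl_sat \<rho> 0 (\<lambda>_. 0) \<phi>"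

end

theory Submission
  imports Defs
begin

text \<open>
  The property separating the logics is ``some later event is followed by two further events
  within less than one time unit''. Take a long word over one letter whose gaps all lie in
  \<open>[1/4, 1)\<close> and in which no two events are an integer distance apart. Whether such a distance
  lies in an interval depends only on its integer part, cut off at the largest endpoint, and every
  unit interval following an event is hit by another event. So an MTL formula cannot tell
  apart positions that are far from both ends of the word, where the meaning of ``far'' depends on
  the formula only. With gaps slightly larger than \<open>1/2\<close> the property fails, but delaying a single
  event in the middle makes it true while the word stays of the above kind.
\<close>

section \<open>Back-and-forth systems for MTL\<close>

abbreviation delay :: "'a tword \<Rightarrow> nat \<Rightarrow> nat \<Rightarrow> real" where
  "delay \<rho> i j \<equiv> time \<rho> j - time \<rho> i"

text \<open>
  Ehrenfeucht-Fraisse moves: \<open>j'\<close> answers the move from \<open>i\<close> to \<open>j\<close> if every position the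
  answer skips is \<open>R\<close>-related to one that the move skips, so that the left argument of the
  temporal operator stays true.
\<close>

definition until_answer ::
  "(real \<Rightarrow> real \<Rightarrow> bool) \<Rightarrow> (nat \<Rightarrow> nat \<Rightarrow> bool) \<Rightarrow> 'a tword \<Rightarrow> 'a tword \<Rightarrow>
     nat \<Rightarrow> nat \<Rightarrow> nat \<Rightarrow> nat \<Rightarrow> bool"
where
  "until_answer E R \<rho> \<rho>' i i' j j' \<longleftrightarrow>
     i' < j' \<and> j' < length \<rho>' \<and> E (delay \<rho> i j) (delay \<rho>' i' j') \<and> R j j' \<and>
     (\<forall>k'\<in>{i'<..<j'}. \<exists>k\<in>{i<..<j}. R k k')"

definition until_forth ::
  "(real \<Rightarrow> real \<Rightarrow> bool) \<Rightarrow> (nat \<Rightarrow> nat \<Rightarrow> bool) \<Rightarrow> 'a tword \<Rightarrow> 'a tword \<Rightarrow> nat \<Rightarrow> nat \<Rightarrow> bool"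
where
  "until_forth E R \<rho> \<rho>' i i' \<longleftrightarrow>
     (\<forall>j. i < j \<and> j < length \<rho> \<longrightarrow> (\<exists>j'. until_answer E R \<rho> \<rho>' i i' j j'))"

definition since_forth ::
  "(real \<Rightarrow> real \<Rightarrow> bool) \<Rightarrow> (nat \<Rightarrow> nat \<Rightarrow> bool) \<Rightarrow> 'a tword \<Rightarrow> 'a tword \<Rightarrow> nat \<Rightarrow> nat \<Rightarrow> bool"
where
  "since_forth E R \<rho> \<rho>' i i' \<longleftrightarrow>
     (\<forall>j<i. \<exists>j'<i'. E (delay \<rho> j i) (delay \<rho>' j' i') \<and> R j j' \<and>
        (\<forall>k'\<in>{j'<..<i'}. \<exists>k\<in>{j<..<i}. R k k'))"

lemma until_answer_same_positions:
  assumes "i < j" "j < length \<rho>'" and "E (delay \<rho> i j) (delay \<rho>' i j)"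
    and "\<And>k. k \<in> {i<..j} \<Longrightarrow> R k k"
  shows "until_answer E R \<rho> \<rho>' i i j j"
  using assms by (force simp: until_answer_def)

lemma until_forth_mono:
  assumes "until_forth E R \<rho> \<rho>' i i'"
    and "\<And>r r'. E r r' \<Longrightarrow> E' r r'" and "\<And>k k'. R k k' \<Longrightarrow> R' k k'"
  shows "until_forth E' R' \<rho> \<rho>' i i'"
  using assms unfolding until_forth_def until_answer_def by meson

lemma since_forth_mono:
  assumes "since_forth E R \<rho> \<rho>' i i'"
    and "\<And>r r'. E r r' \<Longrightarrow> E' r r'" and "\<And>k k'. R k k' \<Longrightarrow> R' k k'"
  shows "since_forth E' R' \<rho> \<rho>' i i'"
  using assms unfolding since_forth_def by meson

abbreviation preserves_interval :: "nat_interval \<Rightarrow> real \<Rightarrow> real \<Rightarrow> bool" where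
  "preserves_interval I r r' \<equiv> r \<in> Rep_nat_interval I \<longrightarrow> r' \<in> Rep_nat_interval I"

lemma until_forth_imp_mtl_sat:
  assumes forth: "until_forth (preserves_interval I) R \<rho> \<rho>' i i'"
    and \<phi>: "\<And>k k'. R k k' \<Longrightarrow> mtl_sat \<rho> k \<phi> \<Longrightarrow> mtl_sat \<rho>' k' \<phi>"
    and \<psi>: "\<And>k k'. R k k' \<Longrightarrow> mtl_sat \<rho> k \<psi> \<Longrightarrow> mtl_sat \<rho>' k' \<psi>"
    and sat: "mtl_sat \<rho> i (MUntil \<phi> I \<psi>)"
  shows "mtl_sat \<rho>' i' (MUntil \<phi> I \<psi>)"
proof -
  obtain j where j: "i < j" "j < length \<rho>" "mtl_sat \<rho> j \<psi>" "delay \<rho> i j \<in> Rep_nat_interval I"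
      "\<And>k. k \<in> {i<..<j} \<Longrightarrow> mtl_sat \<rho> k \<phi>"
    using sat by auto
  then obtain j' where "until_answer (preserves_interval I) R \<rho> \<rho>' i i' j j'"
    using forth by (auto simp: until_forth_def)
  then have j': "i' < j'" "j' < length \<rho>'" "delay \<rho>' i' j' \<in> Rep_nat_interval I" "R j j'"
      and between: "\<forall>k'\<in>{i'<..<j'}. \<exists>k\<in>{i<..<j}. R k k'"
    using j(4) by (auto simp: until_answer_def)
  have "mtl_sat \<rho>' k' \<phi>" if "i' < k'" "k' < j'" for k'
    using that between j(5) \<phi> by (meson greaterThanLessThan_iff)
  with j' j(3) \<psi> show ?thesis by auto
qed

lemma since_forth_imp_mtl_sat:
  assumes forth: "since_forth (preserves_interval I) R \<rho> \<rho>' i i'"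
    and \<phi>: "\<And>k k'. R k k' \<Longrightarrow> mtl_sat \<rho> k \<phi> \<Longrightarrow> mtl_sat \<rho>' k' \<phi>"
    and \<psi>: "\<And>k k'. R k k' \<Longrightarrow> mtl_sat \<rho> k \<psi> \<Longrightarrow> mtl_sat \<rho>' k' \<psi>"
    and sat: "mtl_sat \<rho> i (MSince \<phi> I \<psi>)"
  shows "mtl_sat \<rho>' i' (MSince \<phi> I \<psi>)"
proof -
  obtain j where j: "j < i" "mtl_sat \<rho> j \<psi>" "delay \<rho> j i \<in> Rep_nat_interval I"
      "\<And>k. k \<in> {j<..<i} \<Longrightarrow> mtl_sat \<rho> k \<phi>"
    using sat by auto
  then obtain j' where j': "j' < i'" "delay \<rho>' j' i' \<in> Rep_nat_interval I" "R j j'"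
      and between: "\<forall>k'\<in>{j'<..<i'}. \<exists>k\<in>{j<..<i}. R k k'"
    using forth by (auto simp: since_forth_def)
  have "mtl_sat \<rho>' k' \<phi>" if "j' < k'" "k' < i'" for k'
    using that between j(4) \<phi> by (meson greaterThanLessThan_iff)
  with j' j(2) \<psi> show ?thesis by auto
qed

locale mtl_back_and_forth =
  fixes R :: "nat \<Rightarrow> 'a tword \<Rightarrow> 'a tword \<Rightarrow> nat \<Rightarrow> nat \<Rightarrow> bool"
  assumes R_sym: "R K \<rho> \<rho>' i i' \<Longrightarrow> R K \<rho>' \<rho> i' i"
    and R_antimono: "R K' \<rho> \<rho>' i i' \<Longrightarrow> K \<le> K' \<Longrightarrow> R K \<rho> \<rho>' i i'"
    and R_letter: "R K \<rho> \<rho>' i i' \<Longrightarrow> letter \<rho> i = letter \<rho>' i'"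
    and R_until: "\<exists>K'. \<forall>\<rho> \<rho>' i i'. R K' \<rho> \<rho>' i i' \<longrightarrow>
      until_forth (preserves_interval I) (R K \<rho> \<rho>') \<rho> \<rho>' i i'"
    and R_since: "\<exists>K'. \<forall>\<rho> \<rho>' i i'. R K' \<rho> \<rho>' i i' \<longrightarrow>
      since_forth (preserves_interval I) (R K \<rho> \<rho>') \<rho> \<rho>' i i'"
begin

definition preserved :: "'a mtl \<Rightarrow> nat \<Rightarrow> bool" where
  "preserved \<psi> K \<longleftrightarrow>
     (\<forall>\<rho> \<rho>' i i'. R K \<rho> \<rho>' i i' \<longrightarrow> mtl_sat \<rho> i \<psi> \<longrightarrow> mtl_sat \<rho>' i' \<psi>)"

lemma preservedD:
  "preserved \<psi> K \<Longrightarrow> R K \<rho> \<rho>' i i' \<Longrightarrow> mtl_sat \<rho> i \<psi> \<Longrightarrow> mtl_sat \<rho>' i' \<psi>"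
  unfolding preserved_def by blast

lemma preserved_mono: "preserved \<psi> K \<Longrightarrow> K \<le> K' \<Longrightarrow> preserved \<psi> K'"
  unfolding preserved_def by (meson R_antimono)

lemma preserved_common:
  assumes "\<exists>K. preserved \<phi> K" and "\<exists>K. preserved \<psi> K"
  obtains K where "preserved \<phi> K" "preserved \<psi> K"
  using assms preserved_mono by (metis nat_le_linear)

lemma ex_preserved: "\<exists>K. preserved \<psi> K"
proof (induction \<psi>)
  case (MLetter b)
  show ?case unfolding preserved_def using R_letter by auto
next
  case (MAnd \<phi> \<psi>)
  then obtain K where "preserved \<phi> K" "preserved \<psi> K" by (rule preserved_common)
  then show ?case unfolding preserved_def mtl_sat.simps by blast
next
  case (MNot \<phi>)
  then show ?case unfolding preserved_def mtl_sat.simps by (meson R_sym)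
next
  case (MUntil \<phi> I \<psi>)
  then obtain K where "preserved \<phi> K" "preserved \<psi> K" by (rule preserved_common)
  moreover obtain K' where "\<And>\<rho> \<rho>' i i'. R K' \<rho> \<rho>' i i' \<Longrightarrow>
      until_forth (preserves_interval I) (R K \<rho> \<rho>') \<rho> \<rho>' i i'"
    using R_until by blast
  ultimately have "preserved (MUntil \<phi> I \<psi>) K'"
    unfolding preserved_def[of _ K'] by (blast intro: until_forth_imp_mtl_sat preservedD)
  then show ?case ..
next
  case (MSince \<phi> I \<psi>)
  then obtain K where "preserved \<phi> K" "preserved \<psi> K" by (rule preserved_common)
  moreover obtain K' where "\<And>\<rho> \<rho>' i i'. R K' \<rho> \<rho>' i i' \<Longrightarrow>
      since_forth (preserves_interval I) (R K \<rho> \<rho>') \<rho> \<rho>' i i'"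
    using R_since by blast
  ultimately have "preserved (MSince \<phi> I \<psi>) K'"
    unfolding preserved_def[of _ K'] by (blast intro: since_forth_imp_mtl_sat preservedD)
  then show ?case ..
qed

lemma mtl_sat_invariant:
  obtains K where "\<And>\<rho> \<rho>' i i'. R K \<rho> \<rho>' i i' \<Longrightarrow> mtl_sat \<rho> i \<psi> \<longleftrightarrow> mtl_sat \<rho>' i' \<psi>"
  using ex_preserved[of \<psi>] preservedD R_sym by metis

end

section \<open>Time reversal\<close>

text \<open>Times become negative, so the reversal of a timed word is usually not a timed word.\<close>

definition reverse_word :: "'a tword \<Rightarrow> 'a tword" where
  "reverse_word \<rho> = map (\<lambda>(a, t). (a, - t)) (rev \<rho>)"

lemma length_reverse_word [simp]: "length (reverse_word \<rho>) = length \<rho>"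
  by (simp add: reverse_word_def)

lemma letter_reverse_word [simp]:
  "i < length \<rho> \<Longrightarrow> letter (reverse_word \<rho>) i = letter \<rho> (length \<rho> - Suc i)"
  by (simp add: reverse_word_def letter_def rev_nth split_beta)

lemma time_reverse_word [simp]:
  "i < length \<rho> \<Longrightarrow> time (reverse_word \<rho>) i = - time \<rho> (length \<rho> - Suc i)"
  by (simp add: reverse_word_def time_def rev_nth split_beta)

lemma since_forth_reverse_word:
  assumes i: "i < length \<rho>" and i': "i' < length \<rho>'"
    and forth: "until_forth E R (reverse_word \<rho>) (reverse_word \<rho>')
                  (length \<rho> - Suc i) (length \<rho>' - Suc i')"
    and R: "\<And>k k'. R k k' \<Longrightarrow> R' (length \<rho> - Suc k) (length \<rho>' - Suc k')"
  shows "since_forth E R' \<rho> \<rho>' i i'"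
  unfolding since_forth_def
proof (intro allI impI)
  fix j assume j: "j < i"
  define n n' where "n = length \<rho>" and "n' = length \<rho>'"
  have "n - Suc i < n - Suc j" "n - Suc j < length (reverse_word \<rho>)"
    using i j by (auto simp: n_def)
  then obtain l where "until_answer E R (reverse_word \<rho>) (reverse_word \<rho>')
      (n - Suc i) (n' - Suc i') (n - Suc j) l"
    using forth unfolding until_forth_def n_def n'_def by blast
  then have l: "n' - Suc i' < l" "l < n'" "R (n - Suc j) l"
      and E: "E (delay \<rho> j i) (delay \<rho>' (n' - Suc l) i')"
      and between: "\<forall>k'\<in>{n' - Suc i'<..<l}. \<exists>k\<in>{n - Suc i<..<n - Suc j}. R k k'"
    using i i' j by (auto simp: until_answer_def n_def n'_def)
  have "\<exists>k\<in>{j<..<i}. R' k k'" if k': "k' \<in> {n' - Suc l<..<i'}" for k'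
  proof -
    have "n' - Suc k' \<in> {n' - Suc i'<..<l}" using k' i' by (auto simp: n'_def)
    then obtain k where k: "k \<in> {n - Suc i<..<n - Suc j}" "R k (n' - Suc k')"
      using between by blast
    have "R' (n - Suc k) k'" using R[OF k(2)] k' i' by (simp add: n_def n'_def)
    moreover have "n - Suc k \<in> {j<..<i}" using k(1) by auto
    ultimately show ?thesis by blast
  qed
  moreover have "R' j (n' - Suc l)" using R[OF l(3)] i j by (simp add: n_def n'_def)
  moreover have "n' - Suc l < i'" using l by auto
  ultimately show "\<exists>j'<i'. E (delay \<rho> j i) (delay \<rho>' j' i') \<and> R' j j' \<and>
      (\<forall>k'\<in>{j'<..<i'}. \<exists>k\<in>{j<..<i}. R' k k')"
    using E by blast
qed

section \<open>Regions of non-integral durations\<close>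

definition same_region :: "nat \<Rightarrow> real \<Rightarrow> real \<Rightarrow> bool" where
  "same_region c r s \<longleftrightarrow> r \<notin> \<int> \<and> s \<notin> \<int> \<and> min \<lfloor>r\<rfloor> (int c) = min \<lfloor>s\<rfloor> (int c)"

lemma same_region_beyond:
  "r \<notin> \<int> \<Longrightarrow> s \<notin> \<int> \<Longrightarrow> real c < r \<Longrightarrow> real c < s \<Longrightarrow> same_region c r s"
  unfolding same_region_def by linarith

lemma same_region_unit_interval:
  "r \<notin> \<int> \<Longrightarrow> s \<notin> \<int> \<Longrightarrow> min \<lfloor>r\<rfloor> (int c) = int a \<Longrightarrow> real a < s \<Longrightarrow> s < real a + 1 \<Longrightarrow>
    same_region c r s"
  unfolding same_region_def by linarith

lemma same_region_less_iff:
  assumes "same_region c r s" "a \<le> c"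
  shows "r < real a \<longleftrightarrow> s < real a"
proof -
  have "u < real a \<longleftrightarrow> min \<lfloor>u\<rfloor> (int c) < int a" for u
    using \<open>a \<le> c\<close> by linarith
  then show ?thesis using assms(1) by (simp add: same_region_def)
qed

lemma same_region_preserves_interval:
  obtains c where "\<And>r s. same_region c r s \<Longrightarrow> preserves_interval I r s"
proof -
  obtain a b :: nat where I: "Rep_nat_interval I \<in> {{real a..real b}, {real a..<real b},
      {real a<..real b}, {real a<..<real b}, {real a..}, {real a<..}}"
    using Rep_nat_interval[of I] by auto
  have "preserves_interval I r s" if rs: "same_region (max a b) r s" for r s
  proof -
    have less: "r < real a \<longleftrightarrow> s < real a" "r < real b \<longleftrightarrow> s < real b"
      using same_region_less_iff[OF rs] by auto
    have "u \<le> real d \<longleftrightarrow> u < real d" "real d < u \<longleftrightarrow> real d \<le> u" if "u \<in> {r, s}" for u d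
      using rs that by (auto simp: same_region_def less_le)
    then show ?thesis using I less by (auto simp flip: not_less)
  qed
  then show thesis using that by blast
qed

section \<open>Generic words\<close>

definition generic_word :: "'a \<Rightarrow> 'a tword \<Rightarrow> bool" where
  "generic_word a \<rho> \<longleftrightarrow>
     (\<forall>i < length \<rho>. letter \<rho> i = a) \<and>
     (\<forall>i. Suc i < length \<rho> \<longrightarrow> 1/4 \<le> delay \<rho> i (Suc i) \<and> delay \<rho> i (Suc i) < 1) \<and>
     (\<forall>i j. i < j \<and> j < length \<rho> \<longrightarrow> delay \<rho> i j \<notin> \<int>)"

lemma generic_wordD:
  assumes "generic_word a \<rho>"
  shows "i < length \<rho> \<Longrightarrow> letter \<rho> i = a"
    and "Suc i < length \<rho> \<Longrightarrow> 1/4 \<le> delay \<rho> i (Suc i)"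
    and "Suc i < length \<rho> \<Longrightarrow> delay \<rho> i (Suc i) < 1"
    and "i < j \<Longrightarrow> j < length \<rho> \<Longrightarrow> delay \<rho> i j \<notin> \<int>"
  using assms unfolding generic_word_def by blast+

lemma generic_word_reverse_word:
  assumes gen: "generic_word a \<rho>"
  shows "generic_word a (reverse_word \<rho>)"
  unfolding generic_word_def
proof (intro conjI allI impI)
  fix i assume "i < length (reverse_word \<rho>)"
  then show "letter (reverse_word \<rho>) i = a" using generic_wordD(1)[OF gen] by simp
next
  fix i assume i: "Suc i < length (reverse_word \<rho>)"
  then have "Suc (length \<rho> - Suc (Suc i)) = length \<rho> - Suc i" by simp
  then show "1/4 \<le> delay (reverse_word \<rho>) i (Suc i)" "delay (reverse_word \<rho>) i (Suc i) < 1"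
    using generic_wordD(2,3)[OF gen, of "length \<rho> - Suc (Suc i)"] i by auto
next
  fix i j assume ij: "i < j \<and> j < length (reverse_word \<rho>)"
  then have "length \<rho> - Suc j < length \<rho> - Suc i" "length \<rho> - Suc i < length \<rho>" by auto
  from generic_wordD(4)[OF gen this] ij show "delay (reverse_word \<rho>) i j \<notin> \<int>" by simp
qed

lemma generic_word_index_diff_le:
  assumes gen: "generic_word a \<rho>" and "i \<le> j" "j < length \<rho>"
  shows "real j - real i \<le> 4 * delay \<rho> i j"
  using \<open>i \<le> j\<close> \<open>j < length \<rho>\<close>
proof (induction j rule: dec_induct)
  case (step j)
  then show ?case using generic_wordD(2)[OF gen, of j] by simp
qed simp

lemma generic_word_hits_unit_interval:
  assumes gen: "generic_word a \<rho>" and bound: "i + 4 * (d + 1) < length \<rho>"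
  obtains j where "i < j" "j \<le> i + 4 * (d + 1)" "real d < delay \<rho> i j" "delay \<rho> i j < real d + 1"
proof -
  let ?late = "\<lambda>l. real d < delay \<rho> i (i + l)"
  define l where "l = (LEAST l. ?late l)"
  have "?late (4 * (d + 1))"
    using generic_word_index_diff_le[OF gen _ bound, of i] by simp
  then have l: "?late l" "l \<le> 4 * (d + 1)"
    unfolding l_def by (rule LeastI, rule Least_le)
  then obtain p where p: "l = Suc p" by (cases l) auto
  have "\<not> ?late p" using not_less_Least[of p ?late] p l_def by simp
  moreover have "delay \<rho> (i + p) (Suc (i + p)) < 1"
    using l(2) p bound by (intro generic_wordD(3)[OF gen]) simp
  ultimately show thesis using that[of "i + l"] l p by simp
qed

lemma until_answer_Suc:
  assumes gen: "generic_word a \<rho>" "generic_word a \<rho>'"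
    and lt: "Suc i < length \<rho>" "Suc i' < length \<rho>'"
    and R: "R (Suc i) (Suc i')"
  shows "until_answer (same_region c) R \<rho> \<rho>' i i' (Suc i) (Suc i')"
proof -
  have "\<lfloor>delay \<rho> i (Suc i)\<rfloor> = 0" "\<lfloor>delay \<rho>' i' (Suc i')\<rfloor> = 0"
    using generic_wordD(2,3)[OF gen(1) lt(1)] generic_wordD(2,3)[OF gen(2) lt(2)]
    by (simp_all add: floor_eq_iff)
  moreover have "delay \<rho> i (Suc i) \<notin> \<int>" "delay \<rho>' i' (Suc i') \<notin> \<int>"
    using generic_wordD(4)[OF gen(1) lessI lt(1)] generic_wordD(4)[OF gen(2) lessI lt(2)] .
  ultimately show ?thesis using lt(2) R by (auto simp: until_answer_def same_region_def)
qed

lemma strict_timed_word_generic_word: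
  assumes gen: "generic_word a \<rho>" and nonempty: "\<rho> \<noteq> []" and start: "time \<rho> 0 = 0"
  shows "strict_timed_word \<rho>"
proof -
  have "0 \<le> time \<rho> i" if "i < length \<rho>" for i
    using generic_word_index_diff_le[OF gen, of 0 i] that start by simp
  moreover have "time \<rho> i < time \<rho> (Suc i)" if "Suc i < length \<rho>" for i
    using generic_wordD(2)[OF gen that] by simp
  ultimately show ?thesis
    using nonempty start unfolding strict_timed_word_def timed_word_def by (auto intro: less_imp_le)
qed

section \<open>Positions far from both ends\<close>

definition inner :: "nat \<Rightarrow> nat \<Rightarrow> nat \<Rightarrow> bool" where
  "inner n K i \<longleftrightarrow> K \<le> i \<and> i + K < n"

definition alike :: "nat \<Rightarrow> nat \<Rightarrow> nat \<Rightarrow> nat \<Rightarrow> bool" where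
  "alike n K i j \<longleftrightarrow> i < n \<and> j < n \<and> (i = j \<or> inner n K i \<and> inner n K j)"

definition twins :: "'a \<Rightarrow> nat \<Rightarrow> 'a tword \<Rightarrow> 'a tword \<Rightarrow> bool" where
  "twins a K \<rho> \<rho>' \<longleftrightarrow> generic_word a \<rho> \<and> generic_word a \<rho>' \<and> length \<rho> = length \<rho>' \<and>
     (\<forall>i < length \<rho>. \<not> inner (length \<rho>) K i \<longrightarrow> time \<rho> i = time \<rho>' i)"

lemma inner_antimono: "inner n K' i \<Longrightarrow> K \<le> K' \<Longrightarrow> inner n K i"
  by (simp add: inner_def)

lemma inner_reverse: "i < n \<Longrightarrow> inner n K (n - Suc i) \<longleftrightarrow> inner n K i"
  by (auto simp: inner_def)

lemma alike_refl: "i < n \<Longrightarrow> alike n K i i"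
  by (simp add: alike_def)

lemma alike_inner: "inner n K i \<Longrightarrow> inner n K j \<Longrightarrow> alike n K i j"
  by (simp add: alike_def inner_def)

lemma alike_sym: "alike n K i j \<Longrightarrow> alike n K j i"
  by (auto simp: alike_def)

lemma alike_antimono: "alike n K' i j \<Longrightarrow> K \<le> K' \<Longrightarrow> alike n K i j"
  unfolding alike_def using inner_antimono by blast

lemma alike_reverse: "alike n K i j \<Longrightarrow> alike n K (n - Suc i) (n - Suc j)"
  by (auto simp: alike_def inner_reverse)

lemma twins_sym: "twins a K \<rho> \<rho>' \<Longrightarrow> twins a K \<rho>' \<rho>"
  by (simp add: twins_def)

lemma twins_antimono: "twins a K' \<rho> \<rho>' \<Longrightarrow> K \<le> K' \<Longrightarrow> twins a K \<rho> \<rho>'"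
  unfolding twins_def using inner_antimono by blast

lemma twins_reverse_word:
  "twins a K \<rho> \<rho>' \<Longrightarrow> twins a K (reverse_word \<rho>) (reverse_word \<rho>')"
  by (simp add: twins_def generic_word_reverse_word inner_reverse)

lemma ex_until_answer_inner:
  assumes gen: "generic_word a \<rho>" "generic_word a \<rho>'"
    and len: "length \<rho> = n" "length \<rho>' = n"
    and i: "inner n (K + 4 * (c + 1)) i" and i': "inner n (K + 4 * (c + 1)) i'"
    and j: "Suc i < j" "inner n K j"
  shows "\<exists>j'. until_answer (same_region c) (alike n K) \<rho> \<rho>' i i' j j'"
proof -
  have ij: "i < j" "j < length \<rho>" using j by (auto simp: inner_def len)
  define d where "d = nat (min \<lfloor>delay \<rho> i j\<rfloor> (int c))"
  have "0 \<le> delay \<rho> i j" using generic_word_index_diff_le[OF gen(1), of i j] ij by simp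
  then have d: "min \<lfloor>delay \<rho> i j\<rfloor> (int c) = int d" "d \<le> c"
    by (auto simp: d_def)
  obtain j' where j': "i' < j'" "j' \<le> i' + 4 * (d + 1)"
      and delay': "real d < delay \<rho>' i' j'" "delay \<rho>' i' j' < real d + 1"
    using generic_word_hits_unit_interval[OF gen(2), of i' d] i' d(2) by (auto simp: inner_def len)
  have inner': "inner n K k'" if "i' < k'" "k' \<le> j'" for k'
    using that j'(2) i' d(2) by (auto simp: inner_def)
  have "j' < length \<rho>'" using inner'[of j'] j'(1) by (simp add: inner_def len)
  moreover have "same_region c (delay \<rho> i j) (delay \<rho>' i' j')"
    using generic_wordD(4)[OF gen(1) ij] generic_wordD(4)[OF gen(2) j'(1) \<open>j' < length \<rho>'\<close>]
      d(1) delay' by (rule same_region_unit_interval)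
  moreover have "alike n K j j'" using j(2) inner' j'(1) by (simp add: alike_inner)
  moreover have "\<exists>k\<in>{i<..<j}. alike n K k k'" if "k' \<in> {i'<..<j'}" for k'
  proof
    show "alike n K (Suc i) k'" using i inner'[of k'] that by (auto simp: alike_def inner_def)
    show "Suc i \<in> {i<..<j}" using j(1) by simp
  qed
  ultimately have "until_answer (same_region c) (alike n K) \<rho> \<rho>' i i' j j'"
    using j'(1) by (simp add: until_answer_def)
  then show ?thesis ..
qed

lemma until_answer_far:
  assumes gen: "generic_word a \<rho>" "generic_word a \<rho>'"
    and len: "length \<rho> = n" "length \<rho>' = n"
    and i: "inner n (K + 4 * (c + 1)) i" and i': "inner n (K + 4 * (c + 1)) i'"
    and j: "i < j" "j < n" "\<not> inner n K j"
  shows "until_answer (same_region c) (alike n K) \<rho> \<rho>' i i' j j"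
proof -
  have far: "i + 4 * (c + 1) < j" "i' + 4 * (c + 1) < j"
    using i i' j by (auto simp: inner_def)
  then have "4 * c < j - i" "4 * c < j - i'" by auto
  then have "4 * real c < real j - real i" "4 * real c < real j - real i'"
    using far by (simp_all flip: of_nat_diff)
  then have "real c < delay \<rho> i j" "real c < delay \<rho>' i' j"
    using generic_word_index_diff_le[OF gen(1), of i j]
      generic_word_index_diff_le[OF gen(2), of i' j] far j(2) len by simp_all
  then have "same_region c (delay \<rho> i j) (delay \<rho>' i' j)"
    using generic_wordD(4)[OF gen(1)] generic_wordD(4)[OF gen(2)] far j(2) len
    by (intro same_region_beyond) auto
  moreover have "\<exists>k\<in>{i<..<j}. alike n K k k'" if k': "k' \<in> {i'<..<j}" for k'
  proof (cases "inner n K k'")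
    case True
    then have "alike n K (Suc i) k'" using i by (intro alike_inner) (auto simp: inner_def)
    moreover have "Suc i \<in> {i<..<j}" using far by simp
    ultimately show ?thesis by blast
  next
    case False
    then have "k' \<in> {i<..<j}" using k' i i' by (auto simp: inner_def)
    then show ?thesis using alike_refl j(2) by (metis greaterThanLessThan_iff less_trans)
  qed
  ultimately show ?thesis using far j(2) len by (simp add: until_answer_def alike_refl)
qed

lemma twins_region_change_imp_inner:
  assumes twins: "twins a (K + 8 * (c + 1)) \<rho> \<rho>'" and n: "length \<rho> = n"
    and j: "i < j" "j < n" and change: "\<not> same_region c (delay \<rho> i j) (delay \<rho>' i j)"
  shows "inner n (K + 4 * (c + 1)) i \<and> inner n K j"
proof -
  have gen: "generic_word a \<rho>" "generic_word a \<rho>'" and n': "length \<rho>' = n"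
    using twins n by (auto simp: twins_def)
  have not_Int: "delay \<rho> i j \<notin> \<int>" "delay \<rho>' i j \<notin> \<int>"
    using generic_wordD(4) gen j n n' by metis+
  then have "\<not> (real c < delay \<rho> i j \<and> real c < delay \<rho>' i j)"
    using change same_region_beyond by blast
  then have "real j - real i \<le> 4 * real c"
    using generic_word_index_diff_le[OF gen(1), of i j]
      generic_word_index_diff_le[OF gen(2), of i j] j n n' by auto
  then have "j \<le> i + 4 * c" by linarith
  moreover have "\<not> (time \<rho> i = time \<rho>' i \<and> time \<rho> j = time \<rho>' j)"
    using change not_Int by (auto simp: same_region_def)
  then have "inner n (K + 8 * (c + 1)) i \<or> inner n (K + 8 * (c + 1)) j"
    using twins j n unfolding twins_def by (meson less_trans)
  ultimately show ?thesis using j(1) by (auto simp: inner_def)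
qed

text \<open>
  As gaps are at least \<open>1/4\<close>, a move of integer part at most \<open>c\<close> passes at most \<open>4 * (c + 1)\<close>
  positions. The radius shrinks by twice that much, since a duration can also differ between the
  words because its far end was retimed.
\<close>

lemma twins_until_forth:
  assumes twins: "twins a (K + 8 * (c + 1)) \<rho> \<rho>'" and n: "length \<rho> = n"
    and alike: "alike n (K + 8 * (c + 1)) i i'"
  shows "until_forth (same_region c) (alike n K) \<rho> \<rho>' i i'"
  unfolding until_forth_def
proof (intro allI impI)
  fix j assume "i < j \<and> j < length \<rho>"
  then have j: "i < j" "j < n" using n by auto
  have gen: "generic_word a \<rho>" "generic_word a \<rho>'" and n': "length \<rho>' = n"
    using twins n by (auto simp: twins_def)
  have radius_le: "K + 4 * (c + 1) \<le> K + 8 * (c + 1)" by simp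
  consider (copy) "i' = i" "same_region c (delay \<rho> i j) (delay \<rho>' i j)"
    | (Suc) "inner n (K + 4 * (c + 1)) i" "inner n (K + 4 * (c + 1)) i'" "j = Suc i" "inner n K j"
    | (inner) "inner n (K + 4 * (c + 1)) i" "inner n (K + 4 * (c + 1)) i'" "Suc i < j" "inner n K j"
    | (far) "inner n (K + 4 * (c + 1)) i" "inner n (K + 4 * (c + 1)) i'" "\<not> inner n K j"
    using alike twins_region_change_imp_inner[OF twins n j] inner_antimono[OF _ radius_le]
      Suc_lessI[OF j(1)]
    unfolding alike_def by metis
  then show "\<exists>j'. until_answer (same_region c) (alike n K) \<rho> \<rho>' i i' j j'"
  proof cases
    case copy
    then have "until_answer (same_region c) (alike n K) \<rho> \<rho>' i i' j j"
      using j n' by (auto intro!: until_answer_same_positions alike_refl)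
    then show ?thesis ..
  next
    case Suc
    then have "alike n K (Suc i) (Suc i')" "Suc i' < n"
      by (auto simp: inner_def alike_def)
    then have "until_answer (same_region c) (alike n K) \<rho> \<rho>' i i' j (Suc i')"
      unfolding \<open>j = Suc i\<close> using j(2) n n' \<open>j = Suc i\<close> by (intro until_answer_Suc[OF gen]) auto
    then show ?thesis ..
  next
    case inner
    then show ?thesis using ex_until_answer_inner[OF gen n n'] by blast
  next
    case far
    then show ?thesis using until_answer_far[OF gen n n'] j by blast
  qed
qed

lemma twins_since_forth:
  assumes twins: "twins a (K + 8 * (c + 1)) \<rho> \<rho>'" and n: "length \<rho> = n"
    and alike: "alike n (K + 8 * (c + 1)) i i'"
  shows "since_forth (same_region c) (alike n K) \<rho> \<rho>' i i'"
proof (rule since_forth_reverse_word)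
  have n': "length \<rho>' = n" using twins n by (simp add: twins_def)
  show "i < length \<rho>" "i' < length \<rho>'" using alike n n' by (auto simp: alike_def)
  show "until_forth (same_region c) (alike n K) (reverse_word \<rho>) (reverse_word \<rho>')
      (length \<rho> - Suc i) (length \<rho>' - Suc i')"
    unfolding n n'
    by (rule twins_until_forth[OF twins_reverse_word[OF twins] _ alike_reverse[OF alike]])
      (simp add: n)
  show "alike n K (length \<rho> - Suc k) (length \<rho>' - Suc k')" if "alike n K k k'" for k k'
    unfolding n n' using that by (rule alike_reverse)
qed

interpretation twins: mtl_back_and_forth
  "\<lambda>K \<rho> \<rho>' i i'. twins a K \<rho> \<rho>' \<and> alike (length \<rho>) K i i'" for a :: 'a
proof
  fix K and \<rho> \<rho>' :: "'a tword" and i i'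
  assume R: "twins a K \<rho> \<rho>' \<and> alike (length \<rho>) K i i'"
  then have len: "length \<rho> = length \<rho>'" by (simp add: twins_def)
  show "twins a K \<rho>' \<rho> \<and> alike (length \<rho>') K i' i"
    using R twins_sym alike_sym len by metis
  show "letter \<rho> i = letter \<rho>' i'"
    using R by (auto simp: twins_def alike_def dest: generic_wordD(1))
next
  fix K K' and \<rho> \<rho>' :: "'a tword" and i i'
  assume "twins a K' \<rho> \<rho>' \<and> alike (length \<rho>) K' i i'" "K \<le> K'"
  then show "twins a K \<rho> \<rho>' \<and> alike (length \<rho>) K i i'"
    by (meson twins_antimono alike_antimono)
next
  fix K and I :: nat_interval
  obtain c where c: "\<And>r s. same_region c r s \<Longrightarrow> preserves_interval I r s"
    using same_region_preserves_interval[of I] by blast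
  have twins_le: "twins a K \<rho> \<rho>'" if "twins a (K + 8 * (c + 1)) \<rho> \<rho>'" for \<rho> \<rho>' :: "'a tword"
    using that by (rule twins_antimono) simp
  show "\<exists>K'. \<forall>\<rho> \<rho>' i i'. twins a K' \<rho> \<rho>' \<and> alike (length \<rho>) K' i i' \<longrightarrow>
      until_forth (preserves_interval I)
        (\<lambda>k k'. twins a K \<rho> \<rho>' \<and> alike (length \<rho>) K k k') \<rho> \<rho>' i i'"
    using twins_le c
    by (intro exI[of _ "K + 8 * (c + 1)"]) (blast intro: until_forth_mono twins_until_forth)
  show "\<exists>K'. \<forall>\<rho> \<rho>' i i'. twins a K' \<rho> \<rho>' \<and> alike (length \<rho>) K' i i' \<longrightarrow>
      since_forth (preserves_interval I)
        (\<lambda>k k'. twins a K \<rho> \<rho>' \<and> alike (length \<rho>) K k k') \<rho> \<rho>' i i'"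
    using twins_le c
    by (intro exI[of _ "K + 8 * (c + 1)"]) (blast intro: since_forth_mono twins_since_forth)
qed

section \<open>The separating words\<close>

definition half_grid_word :: "'a \<Rightarrow> nat \<Rightarrow> (nat \<Rightarrow> real) \<Rightarrow> 'a tword" where
  "half_grid_word a n e = map (\<lambda>i. (a, real i / 2 + e i)) [0..<n]"

lemma length_half_grid_word [simp]: "length (half_grid_word a n e) = n"
  by (simp add: half_grid_word_def)

lemma letter_half_grid_word [simp]: "i < n \<Longrightarrow> letter (half_grid_word a n e) i = a"
  by (simp add: half_grid_word_def letter_def)

lemma time_half_grid_word [simp]: "i < n \<Longrightarrow> time (half_grid_word a n e) i = real i / 2 + e i"
  by (simp add: half_grid_word_def time_def)

lemma half_integer_perturbed_not_Int:
  fixes d :: real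
  assumes "\<bar>d\<bar> < 1/2" "d \<noteq> 0"
  shows "of_int m / 2 + d \<notin> \<int>"
proof
  assume "of_int m / 2 + d \<in> \<int>"
  then obtain z where "of_int m / 2 + d = of_int z" by (elim Ints_cases)
  then have d: "2 * d = of_int (2 * z - m)" by (simp add: field_simps)
  have "\<bar>2 * d\<bar> < 1" using assms(1) by linarith
  then have "2 * z - m = 0" unfolding d by linarith
  with d assms(2) show False by simp
qed

lemma generic_word_half_grid_word:
  assumes inj: "inj_on e {..<n}" and range: "e ` {..<n} \<subseteq> {0..<1/4}"
  shows "generic_word a (half_grid_word a n e)"
proof -
  have e: "0 \<le> e i" "e i < 1/4" if "i < n" for i
    using range that by auto
  have "1/4 \<le> delay (half_grid_word a n e) i (Suc i) \<and> delay (half_grid_word a n e) i (Suc i) < 1"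
    if "Suc i < n" for i
    using that e[of i] e[of "Suc i"] by (simp add: field_simps)
  moreover have "delay (half_grid_word a n e) i j \<notin> \<int>" if "i < j" "j < n" for i j
  proof -
    have "e j \<noteq> e i" using inj_onD[OF inj, of j i] that by auto
    moreover have "\<bar>e j - e i\<bar> < 1/2" using e[of i] e[of j] that by linarith
    ultimately have "of_int (int j - int i) / 2 + (e j - e i) \<notin> \<int>"
      by (intro half_integer_perturbed_not_Int) auto
    moreover have "delay (half_grid_word a n e) i j = of_int (int j - int i) / 2 + (e j - e i)"
      using that by (simp add: diff_divide_distrib)
    ultimately show ?thesis by simp
  qed
  ultimately show ?thesis by (simp add: generic_word_def)
qed

definition three_within_unit :: "'x \<Rightarrow> ('a, 'x) tptl" where
  "three_within_unit x = TF (TFreeze x (TF (TF (TGuard (GCmp x Gt (-1))))))"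

lemma tptl_holds_three_within_unit:
  "tptl_holds \<rho> (three_within_unit x) \<longleftrightarrow>
     (\<exists>i j k. 0 < i \<and> i < j \<and> j < k \<and> k < length \<rho> \<and> delay \<rho> i k < 1)"
proof -
  have "- 1 < time \<rho> i - time \<rho> k \<longleftrightarrow> delay \<rho> i k < 1" for i k by linarith
  then show ?thesis
    by (simp add: tptl_holds_def three_within_unit_def) (meson less_trans)
qed

lemma half_grid_word_not_three_within_unit:
  assumes "mono e"
  shows "\<not> tptl_holds (half_grid_word a n e) (three_within_unit x)"
proof -
  have "1 \<le> delay (half_grid_word a n e) i k" if "i < j" "j < k" "k < n" for i j k
  proof -
    have "real i + 2 \<le> real k" using that by linarith
    moreover have "e i \<le> e k" using that by (intro monoD[OF assms]) simp
    ultimately show ?thesis using that by simp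
  qed
  then show ?thesis by (fastforce simp: tptl_holds_three_within_unit)
qed

lemma half_grid_word_three_within_unit:
  assumes "0 < m" "m + 2 < n" "e (m + 2) < e m"
  shows "tptl_holds (half_grid_word a n e) (three_within_unit x)"
proof -
  have "delay (half_grid_word a n e) m (m + 2) < 1" using assms by (simp add: field_simps)
  then show ?thesis
    unfolding tptl_holds_three_within_unit length_half_grid_word
    using assms(1,2) by (intro exI[of _ m] exI[of _ "m + 1"] exI[of _ "m + 2"]) auto
qed

lemma ex_twins_half_grid_words:
  obtains n e e' m where
    "twins a K (half_grid_word a n e) (half_grid_word a n e')"
    "e 0 = 0" "e' 0 = 0" "mono e" "0 < m" "m + 2 < n" "e' (m + 2) < e' m"
proof -
  define n where "n = 2 * K + 6"
  define m where "m = Suc K"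
  define e where "e i = real i / (8 * real n)" for i
  define e' where "e' = e(m := 1/8)"
  have small: "0 \<le> e i" "e i < 1/8" if "i < n" for i
    using that by (auto simp: e_def field_simps)
  have "mono e" by (auto simp: e_def intro!: monoI divide_right_mono)
  have inj: "inj_on e {..<n}" by (auto simp: inj_on_def e_def n_def)
  then have "inj_on e' {..<n}"
    using small(2) by (auto simp: e'_def inj_on_def) (metis less_irrefl)+
  moreover have "e ` {..<n} \<subseteq> {0..<1/4}" "e' ` {..<n} \<subseteq> {0..<1/4}"
    using small by (force simp: e'_def)+
  ultimately have "twins a K (half_grid_word a n e) (half_grid_word a n e')"
    using inj by (auto simp: twins_def generic_word_half_grid_word e'_def inner_def n_def m_def)
  moreover have "e' (m + 2) < e' m" using small(2)[of "m + 2"] by (simp add: e'_def n_def m_def)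
  ultimately show thesis
    using that[of n e e' m] \<open>mono e\<close> by (simp add: e_def e'_def n_def m_def)
qed

lemma mtl_not_equivalent_three_within_unit:
  fixes \<psi> :: "'a mtl"
  obtains \<rho> :: "'a tword"
  where "strict_timed_word \<rho>" "mtl_holds \<rho> \<psi> \<noteq> tptl_holds \<rho> (three_within_unit x)"
proof -
  fix a :: 'a
  obtain K where K: "\<And>\<rho> \<rho>' i i'. twins a K \<rho> \<rho>' \<and> alike (length \<rho>) K i i' \<Longrightarrow>
      mtl_sat \<rho> i \<psi> \<longleftrightarrow> mtl_sat \<rho>' i' \<psi>"
    using twins.mtl_sat_invariant[of a \<psi>] by blast
  obtain n e e' m where twins: "twins a K (half_grid_word a n e) (half_grid_word a n e')"
      and e: "e 0 = 0" "e' 0 = 0" "mono e" and m: "0 < m" "m + 2 < n" "e' (m + 2) < e' m"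
    by (rule ex_twins_half_grid_words)
  let ?\<rho> = "half_grid_word a n e" and ?\<rho>' = "half_grid_word a n e'"
  have "mtl_holds ?\<rho> \<psi> \<longleftrightarrow> mtl_holds ?\<rho>' \<psi>"
    unfolding mtl_holds_def using twins m(2) by (intro K) (simp add: alike_refl)
  moreover have "\<not> tptl_holds ?\<rho> (three_within_unit x)" "tptl_holds ?\<rho>' (three_within_unit x)"
    by (rule half_grid_word_not_three_within_unit[OF e(3)],
        rule half_grid_word_three_within_unit[OF m])
  moreover have "?\<rho> \<noteq> []" "?\<rho>' \<noteq> []"
    using m(2) by (auto simp flip: length_greater_0_conv)
  then have "strict_timed_word ?\<rho>" "strict_timed_word ?\<rho>'"
    using twins e(1,2) m(2) unfolding twins_def
    by (auto intro!: strict_timed_word_generic_word[where a = a])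
  ultimately show thesis using that by blast
qed

theorem theorem5:
  shows "(\<exists>\<phi> :: ('a::finite, 'x::finite) tptl. \<not> (\<exists>\<psi> :: 'a mtl.
            {\<rho>. strict_timed_word \<rho> \<and> mtl_holds \<rho> \<psi>} = {\<rho>. strict_timed_word \<rho> \<and> tptl_holds \<rho> \<phi>}))
       \<and> (\<exists>\<phi> :: ('a, 'x) tptl. \<not> (\<exists>\<psi> :: 'a mtl.
            {\<rho>. timed_word \<rho> \<and> mtl_holds \<rho> \<psi>} = {\<rho>. timed_word \<rho> \<and> tptl_holds \<rho> \<phi>}))"
proof -
  let ?\<phi> = "three_within_unit undefined :: ('a, 'x) tptl"
  have "\<exists>\<rho>. strict_timed_word \<rho> \<and> timed_word \<rho> \<and> mtl_holds \<rho> \<psi> \<noteq> tptl_holds \<rho> ?\<phi>" for \<psi> :: "'a mtl"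
    using mtl_not_equivalent_three_within_unit[of \<psi>] by (metis strict_timed_word_def)
  then show ?thesis by blast
qed

end
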